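(* Let $\mathbb K$ be a field of characteristic $0$, $P$ a set with weights $w_p\in\mathbb Z_{\ge1}$ (finitely many elements of each weight), and for each $p\in P$ let $E_p$ be a finite set with insertion exponents $\mu_e\in\mathbb K$ ($e\in E_p$), and let $\Lambda_p:\mathbb K[\mathbf L_p]\to\mathbb K[L]$ be the 1-cocycle associated to a power series $A_p\in\mathbb K[[\mathbf L_p]]$, where $\mathbf L_p=(L_e)_{e\in E_p}$. If $\sum_{e\in E_p}\mu_e=1$ for each $p\in P$, then the solution of the Dyson--Schwinger equation $$G(x,L)=1+\sum_{p\in P}x^{w_p}\Lambda_p\Big(\prod_{e\in E_p}G(x,L_e)^{\mu_e}\Big)$$ is the same as the solution of the ordinary linear Dyson--Schwinger equation $$G(x,L)=1+\sum_{p\in P}x^{w_p}\int_0^L\tilde A_p(\partial/\partial u)\,G(x,u)\,du,$$ where $\tilde A_p(L)\in\mathbb K[[L]]$ is obtained from $A_p$ by substituting $\mu_eL$ for the variable $L_e$, for every $e\in E_p$.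
   Context: Solutions are series $G(x,L)\in\mathbb K[L][[x]]$ (each equation has a unique one, with constant term $1$ in $x$). Powers of series with constant term $1$ are defined by the binomial series; operators are applied to series in $x$ coefficientwise. The 1-cocycle associated to $A_p\in\mathbb K[[\mathbf L_p]]$ is $$\Lambda_pf=\int_0^LA_p(\partial/\partial u_e:e\in E_p)f(\mathbf u)\big|_{u_e=u\ \forall e\in E_p}\,du,\qquad f\in\mathbb K[\mathbf L_p];$$ these are exactly the linear maps $\Lambda:\mathbb K[\mathbf L_p]\to\mathbb K[L]$ with $\Delta\Lambda=\Lambda\otimes1+(\mathrm{id}\otimes\Lambda)\delta$, where $\Delta L=L\otimes1+1\otimes L$ and $\delta(\mathbf L^\alpha)=\sum_{\beta\le\alpha}\binom\alpha\beta L^{|\alpha|-|\beta|}\otimes\mathbf L^\beta$. *)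

theory Defs
  imports
    "HOL-Library.Poly_Mapping"
    "HOL-Computational_Algebra.Polynomial"
    "HOL-Computational_Algebra.Formal_Power_Series"
begin

text \<open>
  Exponent vectors are finitely supported functions. A polynomial in variables indexed by \<open>'e\<close> is
  an element of the monoid algebra over exponent vectors; a power series is an arbitrary coefficient
  function on exponent vectors. A single type \<open>'e\<close> supplies the variables for all sets \<open>E\<^sub>p\<close>; the
  restriction to a particular variable set is imposed on the exponent vectors.
\<close>

type_synonym 'e expo = "'e \<Rightarrow>\<^sub>0 nat"
type_synonym ('e, 'k) mpoly = "'e expo \<Rightarrow>\<^sub>0 'k"
type_synonym ('e, 'k) mpser = "'e expo \<Rightarrow> 'k"

definition expo_deg :: "'e expo \<Rightarrow> nat" where
  "expo_deg \<alpha> = (\<Sum>e\<in>Poly_Mapping.keys \<alpha>. Poly_Mapping.lookup \<alpha> e)"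

definition mpser_on :: "'e set \<Rightarrow> ('e, 'k::zero) mpser set" where
  "mpser_on E = {A. \<forall>\<alpha>. A \<alpha> \<noteq> 0 \<longrightarrow> Poly_Mapping.keys \<alpha> \<subseteq> E}"

definition mconst :: "'k::zero \<Rightarrow> ('e, 'k) mpoly" where
  "mconst c = Poly_Mapping.single 0 c"

text \<open>
  \<open>\<partial>\<^sup>\<alpha> L\<^sup>\<beta> = (\<Prod>e. \<beta>\<^sub>e (\<beta>\<^sub>e - 1) \<cdots> (\<beta>\<^sub>e - \<alpha>\<^sub>e + 1)) L\<^bsup>\<beta> - \<alpha>\<^esup>\<close>. The product vanishes unless \<open>\<alpha> \<le> \<beta>\<close>
  pointwise, so the truncated subtraction of exponents is harmless.
\<close>

definition mderiv :: "'e expo \<Rightarrow> ('e, 'k::comm_ring_1) mpoly \<Rightarrow> ('e, 'k) mpoly" where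
  "mderiv \<alpha> f = (\<Sum>\<beta>\<in>Poly_Mapping.keys f. Poly_Mapping.single (\<beta> - \<alpha>)
     (Poly_Mapping.lookup f \<beta> * (\<Prod>e\<in>Poly_Mapping.keys \<alpha>. \<Prod>i<Poly_Mapping.lookup \<alpha> e.
        of_nat (Poly_Mapping.lookup \<beta> e) - of_nat i)))"

text \<open>
  \<open>A(\<partial>/\<partial>u\<^sub>e : e) f = \<Sum>\<^sub>\<alpha> A\<^sub>\<alpha> \<partial>\<^sup>\<alpha> f\<close>; all but finitely many terms vanish because \<open>f\<close> is a polynomial
  (see \<open>finite_mderiv_nonzero\<close> below), and exactly these are left out of the sum.
\<close>

definition mpser_op :: "('e, 'k::comm_ring_1) mpser \<Rightarrow> ('e, 'k) mpoly \<Rightarrow> ('e, 'k) mpoly" where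
  "mpser_op A f = (\<Sum>\<alpha> | mderiv \<alpha> f \<noteq> 0. mconst (A \<alpha>) * mderiv \<alpha> f)"

definition mdiag :: "('e, 'k::comm_monoid_add) mpoly \<Rightarrow> 'k poly"
  \<comment> \<open>set all variables equal to the single variable \<open>u\<close>\<close>
  where "mdiag f = (\<Sum>\<beta>\<in>Poly_Mapping.keys f. monom (Poly_Mapping.lookup f \<beta>) (expo_deg \<beta>))"

definition poly_integral0 :: "'k::field_char_0 poly \<Rightarrow> 'k poly"
  \<comment> \<open>\<open>\<integral>\<^sub>0\<^sup>L f(u) du\<close> as a polynomial in \<open>L\<close>\<close>
  where "poly_integral0 f = (\<Sum>i\<le>degree f. monom (coeff f i / of_nat (Suc i)) (Suc i))"

definition cocycle :: "('e, 'k::field_char_0) mpser \<Rightarrow> ('e, 'k) mpoly \<Rightarrow> 'k poly" where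
  "cocycle A f = poly_integral0 (mdiag (mpser_op A f))"

definition fps_op :: "'k::field_char_0 fps \<Rightarrow> 'k poly \<Rightarrow> 'k poly"
  \<comment> \<open>\<open>a(\<partial>/\<partial>u) f = \<Sum>\<^sub>n a\<^sub>n f\<^bsup>(n)\<^esup>\<close>; the terms with \<open>n > degree f\<close> vanish\<close>
  where "fps_op a f = (\<Sum>n\<le>degree f. smult (fps_nth a n) ((pderiv ^^ n) f))"

definition mpser_subst :: "'e set \<Rightarrow> ('e \<Rightarrow> 'k) \<Rightarrow> ('e, 'k::comm_semiring_1) mpser \<Rightarrow> 'k fps"
  \<comment> \<open>substitute \<open>\<mu>\<^sub>e L\<close> for \<open>L\<^sub>e\<close>, for every \<open>e\<close> in the finite set \<open>E\<close>\<close>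
  where "mpser_subst E \<mu> A = Abs_fps (\<lambda>n.
    \<Sum>\<alpha> | Poly_Mapping.keys \<alpha> \<subseteq> E \<and> expo_deg \<alpha> = n.
      A \<alpha> * (\<Prod>e\<in>E. \<mu> e ^ Poly_Mapping.lookup \<alpha> e))"

definition poly_in_var :: "'e \<Rightarrow> 'k::comm_monoid_add poly \<Rightarrow> ('e, 'k) mpoly"
  \<comment> \<open>\<open>f(L) \<mapsto> f(L\<^sub>e)\<close>\<close>
  where "poly_in_var e f =
    (\<Sum>i\<le>degree f. Poly_Mapping.single (Poly_Mapping.single e i) (coeff f i))"

definition fps_coeffwise :: "('a \<Rightarrow> 'b) \<Rightarrow> 'a fps \<Rightarrow> 'b fps" where
  "fps_coeffwise h F = Abs_fps (\<lambda>n. h (fps_nth F n))"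

text \<open>
  \<open>F\<^sup>a = \<Sum>\<^sub>k (a choose k) (F - 1)\<^sup>k\<close>, meaningful for series with constant term 1.
\<close>

definition fps_binpow :: "('e, 'k::field_char_0) mpoly fps \<Rightarrow> 'k \<Rightarrow> ('e, 'k) mpoly fps" where
  "fps_binpow F a = fps_compose (Abs_fps (\<lambda>k. mconst (a gchoose k))) (F - 1)"

text \<open>
  Sum of a family of series such that only finitely many members contribute to each power of \<open>x\<close>.
  In the equations below this holds because \<open>x\<^bsup>w\<^sub>p\<^esup>\<close> divides the \<open>p\<close>-th member.
\<close>

definition fps_family_sum :: "'p set \<Rightarrow> ('p \<Rightarrow> 'a::comm_monoid_add fps) \<Rightarrow> 'a fps" where
  "fps_family_sum P F = Abs_fps (\<lambda>n. \<Sum>p | p \<in> P \<and> fps_nth (F p) n \<noteq> 0. fps_nth (F p) n)"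

text \<open>
  Series \<open>G(x, L)\<close> are elements of \<open>K[L][[x]]\<close>. The constant term 1 is demanded in the first
  equation since otherwise the powers are not defined.
\<close>

definition solves_DSE ::
  "'p set \<Rightarrow> ('p \<Rightarrow> nat) \<Rightarrow> ('p \<Rightarrow> 'e set) \<Rightarrow> ('p \<Rightarrow> 'e \<Rightarrow> 'k) \<Rightarrow> ('p \<Rightarrow> ('e, 'k::field_char_0) mpser)
    \<Rightarrow> 'k poly fps \<Rightarrow> bool" where
  "solves_DSE P w E \<mu> A G \<longleftrightarrow> fps_nth G 0 = 1 \<and>
     G = 1 + fps_family_sum P (\<lambda>p. fps_X ^ w p *
       fps_coeffwise (cocycle (A p))
         (\<Prod>e\<in>E p. fps_binpow (fps_coeffwise (poly_in_var e) G) (\<mu> p e)))"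

definition solves_linear_DSE ::
  "'p set \<Rightarrow> ('p \<Rightarrow> nat) \<Rightarrow> ('p \<Rightarrow> 'k::field_char_0 fps) \<Rightarrow> 'k poly fps \<Rightarrow> bool" where
  "solves_linear_DSE P w a G \<longleftrightarrow>
     G = 1 + fps_family_sum P (\<lambda>p. fps_X ^ w p *
       fps_coeffwise (\<lambda>f. poly_integral0 (fps_op (a p) f)) G)"

lemma finite_mderiv_nonzero: "finite {\<alpha>. mderiv \<alpha> f \<noteq> 0}"
proof -
  let ?S = "\<lambda>\<beta>::'a expo. {\<alpha>. \<forall>e. Poly_Mapping.lookup \<alpha> e \<le> Poly_Mapping.lookup \<beta> e}"
  have fin: "finite (?S \<beta>)" for \<beta> :: "'a expo"
  proof -
    let ?K = "Poly_Mapping.keys \<beta>"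
    let ?T = "{g. \<forall>e. (e \<in> ?K \<longrightarrow> g e \<in> {..expo_deg \<beta>}) \<and> (e \<notin> ?K \<longrightarrow> g e = 0)}"
    have "Poly_Mapping.lookup ` ?S \<beta> \<subseteq> ?T"
    proof
      fix g assume "g \<in> Poly_Mapping.lookup ` ?S \<beta>"
      then have le: "g e \<le> Poly_Mapping.lookup \<beta> e" for e by auto
      have "Poly_Mapping.lookup \<beta> e \<le> expo_deg \<beta>" if "e \<in> ?K" for e
        unfolding expo_deg_def by (rule member_le_sum) (use that in auto)
      moreover have "g e = 0" if "e \<notin> ?K" for e
        using le[of e] that by (simp add: in_keys_iff)
      ultimately show "g \<in> ?T" using le by (auto intro: le_trans)
    qed
    moreover have "finite ?T"
      by (rule finite_set_of_finite_funs) auto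
    ultimately have "finite (Poly_Mapping.lookup ` ?S \<beta>)"
      by (rule finite_subset)
    then show ?thesis
      by (rule finite_imageD) (auto intro: inj_onI poly_mapping_eqI)
  qed
  have "{\<alpha>. mderiv \<alpha> f \<noteq> 0} \<subseteq> (\<Union>\<beta>\<in>Poly_Mapping.keys f. ?S \<beta>)"
  proof (rule subsetI, rule ccontr)
    fix \<alpha> assume nz: "\<alpha> \<in> {\<alpha>. mderiv \<alpha> f \<noteq> 0}"
      and out: "\<alpha> \<notin> (\<Union>\<beta>\<in>Poly_Mapping.keys f. ?S \<beta>)"
    have "(\<Prod>e\<in>Poly_Mapping.keys \<alpha>. \<Prod>i<Poly_Mapping.lookup \<alpha> e.
        (of_nat (Poly_Mapping.lookup \<beta> e) - of_nat i :: 'b)) = 0"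
      if "\<beta> \<in> Poly_Mapping.keys f" for \<beta>
    proof -
      have "\<alpha> \<notin> ?S \<beta>" using out that by blast
      then obtain e where e: "Poly_Mapping.lookup \<beta> e < Poly_Mapping.lookup \<alpha> e"
        by (auto simp: not_le)
      have "(\<Prod>i<Poly_Mapping.lookup \<alpha> e. (of_nat (Poly_Mapping.lookup \<beta> e) - of_nat i :: 'b)) = 0"
        by (rule prod_zero) (use e in auto)
      moreover have "e \<in> Poly_Mapping.keys \<alpha>" using e by (auto simp: in_keys_iff)
      ultimately show ?thesis by (intro prod_zero) auto
    qed
    then have "mderiv \<alpha> f = 0" by (simp add: mderiv_def)
    with nz show False by simp
  qed
  then show ?thesis
    by (rule finite_subset) (simp add: fin)
qed

end

theory Submission
  imports Defs
begin

text \<open>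
  Let \<open>c(x)\<close> be the series without constant term that satisfies \<open>c = \<Sum>\<^sub>p x\<^bsup>w\<^sub>p\<^esup> B\<^sub>p(c)\<close>,
  where \<open>B\<^sub>p(L)\<close> is obtained from \<open>A\<^sub>p\<close> by substituting \<open>\<mu>\<^sub>e L\<close> for \<open>L\<^sub>e\<close>, and put \<open>G = exp (c(x) L)\<close>.
  Since \<open>B\<^sub>p(\<partial>/\<partial>u) exp (c u) = B\<^sub>p(c) exp (c u)\<close>, this \<open>G\<close> solves the linear equation.
  In the nonlinear equation the product of powers is \<open>exp (c \<Sum>\<^sub>e \<mu>\<^sub>e L\<^sub>e)\<close>, on which \<open>A\<^sub>p(\<partial>)\<close>
  again acts as multiplication by \<open>B\<^sub>p(c)\<close>; setting all variables equal to \<open>u\<close> gives \<open>exp (c u)\<close>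
  because \<open>\<Sum>\<^sub>e \<mu>\<^sub>e = 1\<close>. Hence \<open>G\<close> solves both equations. As \<open>w\<^sub>p \<ge> 1\<close>, both right-hand sides
  are contractions in the \<open>x\<close>-adic topology, so the solutions are unique.
\<close>

unbundle fps_syntax

section \<open>Formal power series over a commutative ring\<close>

text \<open>The hypothesis makes \<open>T\<close> a contraction in the x-adic topology: coefficient
  n of the value sees only coefficients below n. Iteration from 0 therefore stabilises each
  coefficient, and induction on n gives uniqueness.\<close>

lemma ex1_fps_fixed_point:
  fixes T :: "'a::zero fps \<Rightarrow> 'a fps"
  assumes "\<And>f g n. (\<And>i. i < n \<Longrightarrow> f $ i = g $ i) \<Longrightarrow> T f $ n = T g $ n"
  shows "\<exists>!f. f = T f"
proof -
  \<comment> \<open>The first iterate already has the right coefficient 0, because the premise of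
    the hypothesis is vacuous for n = 0; hence coefficient n is settled after \<open>Suc n\<close>
    steps.\<close>
  define f where "f = Abs_fps (\<lambda>n. (T ^^ Suc n) 0 $ n)"
  have stable: "(T ^^ m) 0 $ n = f $ n" if "n < m" for m n
    using that
  proof (induction n arbitrary: m rule: less_induct)
    case (less n)
    then obtain k where m: "m = Suc k" by (cases m) auto
    have "(T ^^ k) 0 $ i = (T ^^ n) 0 $ i" if "i < n" for i
      using less.IH[OF that, of k] less.IH[OF that, of n] that less.prems m by simp
    then have "T ((T ^^ k) 0) $ n = T ((T ^^ n) 0) $ n" by (rule assms)
    then show ?case by (simp add: m f_def)
  qed
  have "f = T f"
  proof (rule fps_ext)
    fix n
    have "T f $ n = T ((T ^^ n) 0) $ n"
      by (rule assms) (simp add: stable)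
    then show "f $ n = T f $ n"
      by (simp add: f_def)
  qed
  moreover have "g = h" if g: "g = T g" and h: "h = T h" for g h
  proof (rule fps_ext)
    fix n show "g $ n = h $ n"
    proof (induction n rule: less_induct)
      case (less n)
      then have "T g $ n = T h $ n" by (rule assms)
      then show ?case by (simp only: g[symmetric] h[symmetric])
    qed
  qed
  ultimately show ?thesis by blast
qed

section \<open>Which coefficients enter powers, products and compositions\<close>

lemma fps_power_nth_cong:
  fixes f g :: "'a::semiring_1 fps"
  assumes "\<And>i. i \<le> n \<Longrightarrow> f $ i = g $ i" "j \<le> n"
  shows "(f ^ k) $ j = (g ^ k) $ j"
  using assms(2)
  by (induction k arbitrary: j) (auto simp: fps_mult_nth assms(1) intro!: sum.cong)

lemma fps_prod_nth_cong:
  fixes f g :: "'b \<Rightarrow> 'a::comm_semiring_1 fps"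
  assumes "\<And>e i. e \<in> S \<Longrightarrow> i \<le> n \<Longrightarrow> f e $ i = g e $ i" "j \<le> n"
  shows "(\<Prod>e\<in>S. f e) $ j = (\<Prod>e\<in>S. g e) $ j"
  using assms
proof (induction S arbitrary: j rule: infinite_finite_induct)
  case (insert x S)
  then show ?case
    by (auto simp: fps_mult_nth intro!: sum.cong)
qed auto

lemma fps_compose_nth_cong:
  fixes f g :: "'a::comm_semiring_1 fps"
  assumes "\<And>i. i \<le> n \<Longrightarrow> f $ i = g $ i"
  shows "(h oo f) $ n = (h oo g) $ n"
  using fps_power_nth_cong[OF assms] by (simp add: fps_compose_nth)

lemma fps_power_nth_eq_0:
  fixes c :: "'a::comm_semiring_1 fps"
  assumes "c $ 0 = 0" "n < k"
  shows "(c ^ k) $ n = 0"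
  using assms startsby_zero_power_prefix by blast

text \<open>Powers \<open>c ^ i\<close> with i > n do not reach order n, so any bound N \<ge> n
  serves. A bound common to several coefficients allows sums to be interchanged.\<close>

lemma fps_compose_nth_upto:
  fixes c :: "'a::comm_semiring_1 fps"
  assumes "c $ 0 = 0" "n \<le> N"
  shows "(f oo c) $ n = (\<Sum>i\<le>N. f $ i * (c ^ i) $ n)"
  unfolding fps_compose_nth using assms
  by (intro sum.mono_neutral_left) (auto simp: fps_power_nth_eq_0)

text \<open>The library has these composition rules only over integral domains; a polynomial ring whose
  variable set carries no linear order is not an instance of that class.\<close>

lemma fps_compose_mult_comm_ring:
  fixes c :: "'a::comm_ring_1 fps"
  assumes c: "c $ 0 = 0"
  shows "(f * g) oo c = (f oo c) * (g oo c)"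
proof (rule fps_ext)
  fix n
  have "((f oo c) * (g oo c)) $ n =
      (\<Sum>j\<le>n. (\<Sum>k\<le>n. f $ k * (c ^ k) $ j) * (\<Sum>m\<le>n. g $ m * (c ^ m) $ (n - j)))"
    unfolding fps_mult_nth atLeast0AtMost
    by (intro sum.cong refl) (simp add: fps_compose_nth_upto[OF c, of _ n])
  also have "\<dots> = (\<Sum>k\<le>n. \<Sum>m\<le>n. \<Sum>j\<le>n. f $ k * g $ m * ((c ^ k) $ j * (c ^ m) $ (n - j)))"
    unfolding sum_product
    by (subst sum.swap, rule sum.cong[OF refl], subst sum.swap) (simp add: mult_ac)
  also have "\<dots> = (\<Sum>k\<le>n. \<Sum>m\<le>n. f $ k * g $ m * (c ^ (k + m)) $ n)"
    by (simp add: power_add fps_mult_nth sum_distrib_left atLeast0AtMost)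
  also have "\<dots> = (\<Sum>(k, m)\<in>{..n} \<times> {..n}. f $ k * g $ m * (c ^ (k + m)) $ n)"
    by (simp add: sum.cartesian_product)
  \<comment> \<open>Outside the triangle, \<open>c ^ (k + m)\<close> starts beyond order n.\<close>
  also have "\<dots> = (\<Sum>(k, m)\<in>{(k, m). k + m \<le> n}. f $ k * g $ m * (c ^ (k + m)) $ n)"
    by (rule sum.mono_neutral_right) (auto, metis c fps_power_nth_eq_0 mult_zero_right not_le_imp_less)
  also have "\<dots> = (\<Sum>s\<le>n. \<Sum>i\<le>s. f $ i * g $ (s - i) * (c ^ s) $ n)"
    by (subst sum.triangle_reindex_eq) simp
  also have "\<dots> = ((f * g) oo c) $ n"
    by (simp add: fps_compose_nth fps_mult_nth sum_distrib_right atLeast0AtMost)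
  finally show "((f * g) oo c) $ n = ((f oo c) * (g oo c)) $ n" by simp
qed

lemma fps_compose_power_comm_ring:
  fixes c :: "'a::comm_ring_1 fps"
  assumes "c $ 0 = 0"
  shows "f ^ k oo c = (f oo c) ^ k"
  by (induction k) (simp_all add: fps_compose_mult_comm_ring[OF assms])

lemma fps_compose_assoc_comm_ring:
  fixes b c :: "'a::comm_ring_1 fps"
  assumes b: "b $ 0 = 0" and c: "c $ 0 = 0"
  shows "f oo (b oo c) = (f oo b) oo c"
proof (rule fps_ext)
  fix n
  have bc: "(b oo c) $ 0 = 0" using b by simp
  have "(f oo (b oo c)) $ n = (\<Sum>i\<le>n. f $ i * (\<Sum>j\<le>n. (b ^ i) $ j * (c ^ j) $ n))"
    by (simp add: fps_compose_nth_upto[OF bc order_refl] fps_compose_nth_upto[OF c order_refl]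
        flip: fps_compose_power_comm_ring[OF c])
  also have "\<dots> = (\<Sum>j\<le>n. (\<Sum>i\<le>n. f $ i * (b ^ i) $ j) * (c ^ j) $ n)"
    by (simp add: sum_distrib_left sum_distrib_right mult.assoc) (rule sum.swap)
  also have "\<dots> = ((f oo b) oo c) $ n"
    by (simp add: fps_compose_nth_upto[OF c order_refl] fps_compose_nth_upto[OF b, of _ n])
  finally show "(f oo (b oo c)) $ n = ((f oo b) oo c) $ n" .
qed

lemma fps_compose_prod_comm_ring:
  fixes c :: "'a::comm_ring_1 fps"
  assumes "c $ 0 = 0"
  shows "(\<Prod>x\<in>S. f x) oo c = (\<Prod>x\<in>S. f x oo c)"
  by (induction S rule: infinite_finite_induct)
     (simp_all add: fps_compose_mult_comm_ring[OF assms])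

text \<open>The composite is (1 + (exp x - 1))^a. Since the binomial series satisfies (1 + x) y' = a
  y, the composite satisfies y' = a y, and its constant term is 1.\<close>

lemma fps_binomial_compose_exp:
  fixes a :: "'k::field_char_0"
  shows "fps_binomial a oo (fps_exp 1 - 1) = fps_exp a"
proof -
  let ?Y = "fps_exp 1 - 1 :: 'k fps"
  let ?B = "fps_binomial a oo ?Y"
  have Y0: "?Y $ 0 = 0" by simp
  have unit: "(1 + fps_X :: 'k fps) $ 0 \<noteq> 0" by simp
  have "fps_deriv ?B = (fps_deriv (fps_binomial a) oo ?Y) * fps_exp 1"
    by (simp add: fps_compose_deriv[OF Y0])
  also have "\<dots> = (fps_deriv (fps_binomial a) oo ?Y) * ((1 + fps_X) oo ?Y)"
    by (simp add: fps_compose_add_distrib fps_X_fps_compose_startby0[OF Y0])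
  also have "\<dots> = (fps_deriv (fps_binomial a) * (1 + fps_X)) oo ?Y"
    by (simp add: fps_compose_mult_distrib[OF Y0])
  also have "fps_deriv (fps_binomial a) * (1 + fps_X) = fps_const a * fps_binomial a"
    unfolding fps_binomial_deriv using unit
    by (simp add: fps_divide_unit mult.assoc inverse_mult_eq_1)
  also have "\<dots> oo ?Y = fps_const a * ?B"
    by (simp add: fps_compose_mult_distrib[OF Y0])
  finally have "?B = fps_const (?B $ 0) * fps_exp a"
    by (simp only: fps_exp_unique_ODE)
  then show ?thesis by simp
qed

section \<open>Exponential series over the polynomial ring\<close>

lemma mconst_0 [simp]: "mconst 0 = 0"
  by (simp add: mconst_def)

lemma mconst_1 [simp]: "mconst 1 = 1"
  by (simp add: mconst_def)

lemma mconst_add: "mconst (a + b) = mconst a + mconst b"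
  by (simp add: mconst_def single_add)

lemma mconst_mult: "mconst (a * b) = mconst a * mconst b" for a b :: "'k::semiring_0"
  by (simp add: mconst_def mult_single)

lemma mconst_sum: "mconst (sum f S) = (\<Sum>i\<in>S. mconst (f i))"
  by (induction S rule: infinite_finite_induct) (simp_all add: mconst_add)

lemma mconst_power: "mconst (a ^ n) = mconst a ^ n" for a :: "'k::comm_semiring_1"
  by (induction n) (simp_all add: mconst_mult)

lemma mconst_of_nat: "mconst (of_nat n) = of_nat n"
  by (simp add: mconst_def)

abbreviation fps_mconst :: "'k::zero fps \<Rightarrow> ('e, 'k) mpoly fps" where
  "fps_mconst \<equiv> fps_coeffwise mconst"

lemma fps_coeffwise_nth [simp]: "fps_coeffwise h F $ n = h (F $ n)"
  by (simp add: fps_coeffwise_def)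

lemma fps_mconst_power: "fps_mconst F ^ k = fps_mconst (F ^ k)"
  for F :: "'k::comm_semiring_1 fps"
  by (induction k)
     (auto simp: fps_eq_iff fps_mult_nth mconst_sum mconst_mult intro!: sum.cong)

text \<open>The series exp(l x), with x the series variable.\<close>

definition mexp :: "('e, 'k::field_char_0) mpoly \<Rightarrow> ('e, 'k) mpoly fps" where
  "mexp l = Abs_fps (\<lambda>k. mconst (1 / fact k) * l ^ k)"

lemma mexp_nth [simp]: "mexp l $ k = mconst (1 / fact k) * l ^ k"
  by (simp add: mexp_def)

lemma mexp_0 [simp]: "mexp 0 = 1"
  by (simp add: fps_eq_iff power_0_left)

lemma mexp_add: "mexp (l + m) = mexp l * mexp m"
proof (rule fps_ext)
  fix n
  have "mconst (1 / fact n) * (of_nat (n choose i) * l ^ i * m ^ (n - i)) =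
      mconst (1 / fact i) * l ^ i * (mconst (1 / fact (n - i)) * m ^ (n - i))"
    if "i \<le> n" for i
  proof -
    have "1 / fact n * of_nat (n choose i) = 1 / fact i * (1 / fact (n - i) :: 'b)"
      using that by (simp add: binomial_fact)
    then have "mconst (1 / fact n) * of_nat (n choose i) =
        mconst (1 / fact i) * (mconst (1 / fact (n - i)) :: ('a, 'b) mpoly)"
      by (metis mconst_mult mconst_of_nat)
    then have "mconst (1 / fact n) * of_nat (n choose i) * (l ^ i * m ^ (n - i)) =
        mconst (1 / fact i) * mconst (1 / fact (n - i)) * (l ^ i * m ^ (n - i))"
      by (rule arg_cong)
    then show ?thesis by (simp only: mult_ac)
  qed
  then show "mexp (l + m) $ n = (mexp l * mexp m) $ n"
    by (simp add: fps_mult_nth binomial_ring sum_distrib_left atLeast0AtMost)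
qed

lemma mexp_sum: "finite S \<Longrightarrow> mexp (\<Sum>x\<in>S. l x) = (\<Prod>x\<in>S. mexp (l x))"
  by (induction S rule: finite_induct) (simp_all add: mexp_add)

text \<open>The scalar identity for exp x, \<open>fps_binomial_compose_exp\<close>, is transported
  along the substitution of l x for x.\<close>

lemma fps_binpow_mexp:
  fixes l :: "('e, 'k::field_char_0) mpoly"
  shows "fps_binpow (mexp l) a = mexp (mconst a * l)"
proof (rule fps_ext)
  fix n
  let ?Y = "fps_exp 1 - 1 :: 'k fps"
  \<comment> \<open>Homogeneity: in \<open>mexp l - 1\<close> the variable x occurs only as l x, so
    coefficient j of a power is the scalar one times \<open>l ^ j\<close>.\<close>
  have scale: "((mexp l - 1) ^ k) $ j = l ^ j * mconst ((?Y ^ k) $ j)" for j k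
  proof (induction k arbitrary: j)
    case 0
    then show ?case by (simp add: fps_one_nth)
  next
    case (Suc k)
    have "(mexp l - 1) $ i = l ^ i * mconst (?Y $ i)" for i
      by (cases i) (simp_all add: mult.commute del: fact_Suc power_Suc)
    moreover have "l ^ i * u * (l ^ (j - i) * v) = l ^ j * (u * v)" if "i \<le> j" for i u v
      using that by (simp add: mult_ac flip: power_add mult.assoc)
    ultimately show ?case
      unfolding power_Suc fps_mult_nth mconst_sum sum_distrib_left
      by (intro sum.cong refl) (simp only: Suc.IH mconst_mult atLeastAtMost_iff)
  qed
  have "fps_binpow (mexp l) a $ n = l ^ n * mconst (\<Sum>i=0..n. (a gchoose i) * (?Y ^ i) $ n)"
    unfolding fps_binpow_def fps_compose_nth scale mconst_sum sum_distrib_left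
    by (intro sum.cong refl) (simp only: fps_nth_Abs_fps mconst_mult mult_ac)
  also have "(\<Sum>i=0..n. (a gchoose i) * (?Y ^ i) $ n) = fps_exp a $ n"
    by (simp only: fps_binomial_compose_exp[of a, symmetric] fps_compose_nth fps_binomial_nth)
  also have "l ^ n * mconst (fps_exp a $ n) = mexp (mconst a * l) $ n"
  proof -
    have "mconst (a ^ n / fact n) = mconst (1 / fact n) * (mconst a ^ n :: ('e, 'k) mpoly)"
      by (simp flip: mconst_mult mconst_power)
    then show ?thesis by (simp add: power_mult_distrib mult_ac)
  qed
  finally show "fps_binpow (mexp l) a $ n = mexp (mconst a * l) $ n" .
qed

text \<open>The binomial power is itself a composition, with inner series \<open>F - 1\<close>, so
  this is associativity; the two conditions provide zero constant terms.\<close>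

lemma fps_binpow_compose:
  assumes "F $ 0 = 1" "c $ 0 = 0"
  shows "fps_binpow (F oo c) a = fps_binpow F a oo c"
proof -
  have "(F oo c) - 1 = (F - 1) oo c"
    by (simp add: fps_compose_sub_distrib)
  then show ?thesis
    unfolding fps_binpow_def using assms by (simp add: fps_compose_assoc_comm_ring)
qed

section \<open>The series exp(c(x) L) and products of its powers\<close>

definition mvar :: "'e \<Rightarrow> ('e, 'k::zero_neq_one) mpoly" where
  "mvar e = Poly_Mapping.single (Poly_Mapping.single e 1) 1"

lemma mvar_power: "(mvar e :: ('e, 'k::comm_semiring_1) mpoly) ^ i = Poly_Mapping.single (Poly_Mapping.single e i) 1"
  by (induction i) (simp_all add: mvar_def mult_single flip: single_add)

lemma poly_in_var_upto:
  fixes f :: "'k::comm_semiring_1 poly"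
  assumes "degree f \<le> N"
  shows "poly_in_var e f = (\<Sum>i\<le>N. mconst (coeff f i) * mvar e ^ i)"
  unfolding poly_in_var_def using assms
  by (intro sum.mono_neutral_cong_left) (auto simp: mvar_power mconst_def mult_single coeff_eq_0)

text \<open>The series exp(c(x) L), sorted by powers of x. If c has constant term 0, the truncation
  at k \<le> n loses nothing, as \<open>c ^ k\<close> starts at order k or later.\<close>

definition exp_fps :: "'k::field_char_0 fps \<Rightarrow> 'k poly fps" where
  "exp_fps c = Abs_fps (\<lambda>n. \<Sum>k\<le>n. monom ((c ^ k) $ n / fact k) k)"

lemma coeff_exp_fps:
  assumes "c $ 0 = 0"
  shows "coeff (exp_fps c $ n) m = (c ^ m) $ n / fact m"
proof -
  have "coeff (exp_fps c $ n) m = (\<Sum>k\<le>n. if k = m then (c ^ k) $ n / fact k else 0)"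
    by (simp add: exp_fps_def coeff_sum)
  also have "\<dots> = (c ^ m) $ n / fact m"
    using assms by (auto simp: fps_power_nth_eq_0)
  finally show ?thesis .
qed

lemma degree_exp_fps: "c $ 0 = 0 \<Longrightarrow> degree (exp_fps c $ n) \<le> n"
  by (intro degree_le) (simp add: coeff_exp_fps fps_power_nth_eq_0)

lemma mexp_compose_nth:
  fixes l :: "('e, 'k::field_char_0) mpoly"
  assumes "c $ 0 = 0"
  shows "(mexp l oo fps_mconst c) $ n = (\<Sum>k\<le>n. mconst ((c ^ k) $ n / fact k) * l ^ k)"
proof -
  have "mconst (1 / fact k) * l ^ k * mconst ((c ^ k) $ n) = mconst ((c ^ k) $ n / fact k) * l ^ k" for k
  proof -
    have "mconst ((c ^ k) $ n / fact k) = mconst (1 / fact k) * (mconst ((c ^ k) $ n) :: ('e, 'k) mpoly)"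
      by (simp flip: mconst_mult)
    then show ?thesis by (simp only: mult_ac)
  qed
  then show ?thesis
    by (simp add: fps_compose_nth fps_mconst_power atLeast0AtMost)
qed

lemma poly_in_var_exp_fps:
  assumes "c $ 0 = 0"
  shows "fps_coeffwise (poly_in_var e) (exp_fps c) = mexp (mvar e) oo fps_mconst c"
  by (rule fps_ext)
    (simp add: mexp_compose_nth[OF assms] poly_in_var_upto[OF degree_exp_fps[OF assms]]
      coeff_exp_fps[OF assms])

definition linear_form :: "'e set \<Rightarrow> ('e \<Rightarrow> 'k) \<Rightarrow> ('e, 'k::comm_semiring_1) mpoly" where
  "linear_form E \<mu> = (\<Sum>e\<in>E. mconst (\<mu> e) * mvar e)"

text \<open>Each factor is exp(c \<mu>_e L_e), so the product is the exponential of c times the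
  linear form. The expansion in powers of the form prepares the use of differential
  operators.\<close>

lemma prod_binpow_exp_fps_nth:
  assumes "c $ 0 = 0" "finite E"
  shows "(\<Prod>e\<in>E. fps_binpow (fps_coeffwise (poly_in_var e) (exp_fps c)) (\<mu> e)) $ n =
    (\<Sum>k\<le>n. mconst ((c ^ k) $ n / fact k) * linear_form E \<mu> ^ k)"
proof -
  have c0: "fps_mconst c $ 0 = 0" using assms by simp
  have "(\<Prod>e\<in>E. fps_binpow (fps_coeffwise (poly_in_var e) (exp_fps c)) (\<mu> e)) =
      mexp (linear_form E \<mu>) oo fps_mconst c"
    unfolding linear_form_def mexp_sum[OF assms(2)] fps_compose_prod_comm_ring[OF c0]
    by (simp add: poly_in_var_exp_fps[OF assms(1)] fps_binpow_compose assms(1) fps_binpow_mexp)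
  then show ?thesis by (simp add: mexp_compose_nth[OF assms(1)])
qed

section \<open>Differential operators on powers of a linear form\<close>

abbreviation lookup where "lookup \<equiv> Poly_Mapping.lookup"
abbreviation keys where "keys \<equiv> Poly_Mapping.keys"

definition mfact :: "'e expo \<Rightarrow> 'k::field_char_0" where
  "mfact \<alpha> = (\<Prod>e\<in>keys \<alpha>. fact (lookup \<alpha> e))"

lemma mfact_superset: "finite S \<Longrightarrow> keys \<alpha> \<subseteq> S \<Longrightarrow> mfact \<alpha> = (\<Prod>e\<in>S. fact (lookup \<alpha> e))"
  unfolding mfact_def by (rule prod.mono_neutral_left) (auto simp: in_keys_iff)

lemma mfact_nonzero [simp]: "mfact \<alpha> \<noteq> 0"
  by (simp add: mfact_def)

lemma keys_add_nat: "keys (\<alpha> + \<beta>) = keys \<alpha> \<union> keys \<beta>" for \<alpha> \<beta> :: "'e expo"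
  by (auto simp: in_keys_iff lookup_add)

lemma expo_deg_superset: "finite S \<Longrightarrow> keys \<alpha> \<subseteq> S \<Longrightarrow> expo_deg \<alpha> = (\<Sum>e\<in>S. lookup \<alpha> e)"
  unfolding expo_deg_def by (rule sum.mono_neutral_left) (auto simp: in_keys_iff)

lemma expo_deg_add: "expo_deg (\<alpha> + \<beta>) = expo_deg \<alpha> + expo_deg \<beta>"
proof -
  have "finite (keys \<alpha> \<union> keys \<beta>)" by simp
  then show ?thesis
    by (simp add: expo_deg_superset[of "keys \<alpha> \<union> keys \<beta>"] keys_add_nat lookup_add sum.distrib)
qed

lemma expo_deg_single [simp]: "expo_deg (Poly_Mapping.single e n) = n"
  by (simp add: expo_deg_def)

lemma expo_deg_0 [simp]: "expo_deg 0 = 0"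
  by (simp add: expo_deg_def)

lemma expo_deg_eq_0_iff: "expo_deg \<alpha> = 0 \<longleftrightarrow> \<alpha> = 0"
  by (auto simp: expo_deg_def in_keys_iff intro!: poly_mapping_eqI)

lemma fact_add_eq_prod:
  "fact (m + n) = (fact m * (\<Prod>i<n. of_nat (m + n) - of_nat i) :: 'k::field_char_0)"
proof (induction n arbitrary: m)
  case (Suc n)
  have "fact (m + Suc n) = (of_nat (Suc (m + n)) * fact (m + n) :: 'k)" by simp
  also have "\<dots> = fact m * (of_nat (m + Suc n) * (\<Prod>i<n. of_nat (m + n) - of_nat i))"
    unfolding Suc.IH by simp
  also have "(\<Prod>i<n. of_nat (m + n) - of_nat i) = (\<Prod>i<n. of_nat (m + Suc n) - of_nat (Suc i) :: 'k)"
    by simp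
  finally show ?case by (subst prod.lessThan_Suc_shift) simp
qed simp

text \<open>Up to the rescaling of coefficients by \<open>\<beta>!\<close>, the operator \<open>\<partial>\<^sup>\<alpha>\<close> is the shift by \<open>\<alpha>\<close>.\<close>

lemma lookup_mderiv:
  "lookup (mderiv \<alpha> f) \<gamma> * mfact \<gamma> = lookup f (\<gamma> + \<alpha>) * (mfact (\<gamma> + \<alpha>) :: 'k::field_char_0)"
proof -
  let ?c = "\<lambda>\<beta>. \<Prod>e\<in>keys \<alpha>. \<Prod>i<lookup \<alpha> e. of_nat (lookup \<beta> e) - of_nat i :: 'k"
  let ?S = "keys \<gamma> \<union> keys \<alpha>"
  have shift: "mfact (\<gamma> + \<alpha>) = ?c (\<gamma> + \<alpha>) * mfact \<gamma>"
  proof -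
    have "mfact (\<gamma> + \<alpha>) = (\<Prod>e\<in>?S. fact (lookup \<gamma> e) *
        (\<Prod>i<lookup \<alpha> e. of_nat (lookup (\<gamma> + \<alpha>) e) - of_nat i) :: 'k)"
      by (subst mfact_superset[of ?S]) (auto simp: keys_add_nat lookup_add fact_add_eq_prod
          simp del: of_nat_add)
    also have "\<dots> = mfact \<gamma> *
        (\<Prod>e\<in>?S. \<Prod>i<lookup \<alpha> e. of_nat (lookup (\<gamma> + \<alpha>) e) - of_nat i)"
      by (subst mfact_superset[of ?S]) (auto simp: prod.distrib)
    also have "(\<Prod>e\<in>?S. \<Prod>i<lookup \<alpha> e. of_nat (lookup (\<gamma> + \<alpha>) e) - of_nat i) = ?c (\<gamma> + \<alpha>)"
      by (rule prod.mono_neutral_right) (auto simp: in_keys_iff)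
    finally show ?thesis by simp
  qed
  \<comment> \<open>Truncated subtraction may send several exponents \<beta> to \<gamma>. Those
    other than \<gamma> + \<alpha> have some \<beta>_e < \<alpha>_e, so the factor with i =
    \<beta>_e is zero.\<close>
  have vanish: "?c \<beta> = 0" if "\<beta> - \<alpha> = \<gamma>" "\<beta> \<noteq> \<gamma> + \<alpha>" for \<beta>
  proof -
    from that(2) obtain e where e: "lookup \<beta> e \<noteq> lookup (\<gamma> + \<alpha>) e"
      by (meson poly_mapping_eqI)
    with that(1) have "lookup \<beta> e < lookup \<alpha> e"
      by (auto simp: lookup_add lookup_minus)
    then show ?thesis
      by (intro prod_zero[OF _ bexI[of _ e]] prod_zero[OF _ bexI[of _ "lookup \<beta> e"]])
        (auto simp: in_keys_iff)
  qed
  have "lookup (mderiv \<alpha> f) \<gamma> =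
      (\<Sum>\<beta>\<in>keys f. if \<beta> = \<gamma> + \<alpha> then lookup f (\<gamma> + \<alpha>) * ?c (\<gamma> + \<alpha>) else 0)"
    unfolding mderiv_def lookup_sum
    by (rule sum.cong) (auto simp: lookup_single when_def vanish)
  also have "\<dots> = lookup f (\<gamma> + \<alpha>) * ?c (\<gamma> + \<alpha>)"
    by (auto simp: in_keys_iff)
  finally show ?thesis by (simp add: shift)
qed

lemma mderiv_eqI:
  fixes g :: "('e, 'k::field_char_0) mpoly"
  assumes "\<And>\<gamma>. lookup f (\<gamma> + \<alpha>) * mfact (\<gamma> + \<alpha>) = lookup g \<gamma> * (mfact \<gamma> :: 'k)"
  shows "mderiv \<alpha> f = g"
proof (rule poly_mapping_eqI)
  fix \<gamma>
  have "lookup (mderiv \<alpha> f) \<gamma> * mfact \<gamma> = lookup g \<gamma> * (mfact \<gamma> :: 'k)"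
    by (simp only: lookup_mderiv assms)
  then show "lookup (mderiv \<alpha> f) \<gamma> = lookup g \<gamma>" by simp
qed

lemma mderiv_add: "mderiv \<alpha> (f + g) = mderiv \<alpha> f + (mderiv \<alpha> g :: ('e, 'k::field_char_0) mpoly)"
  by (rule mderiv_eqI) (simp add: lookup_add distrib_right lookup_mderiv)

text \<open>The condition \<open>\<alpha> + (\<beta> - \<alpha>) = \<beta>\<close> encodes \<alpha>
  \<le> \<beta> pointwise, that is, that the subtraction is not truncated.\<close>

lemma lookup_single_times:
  "lookup (Poly_Mapping.single \<alpha> c * f) \<beta> =
    (if \<alpha> + (\<beta> - \<alpha>) = \<beta> then c * lookup f (\<beta> - \<alpha>) else 0)"
  for \<alpha> :: "'e expo" and f :: "('e, 'k::semiring_0) mpoly"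
proof -
  have "lookup (Poly_Mapping.single \<alpha> c * f) \<beta> =
      Sum_any (\<lambda>l. (c when l = \<alpha>) * Sum_any (\<lambda>q. lookup f q when \<beta> = l + q))"
    by (simp add: lookup_mult lookup_single eq_commute[of \<alpha>])
  also have "\<dots> = c * Sum_any (\<lambda>q. lookup f q when \<beta> = \<alpha> + q)"
    by (simp add: when_mult)
  also have "Sum_any (\<lambda>q. lookup f q when \<beta> = \<alpha> + q) =
      (if \<alpha> + (\<beta> - \<alpha>) = \<beta> then lookup f (\<beta> - \<alpha>) else 0)"
  proof (cases "\<alpha> + (\<beta> - \<alpha>) = \<beta>")
    case True
    then have "\<beta> = \<alpha> + q \<longleftrightarrow> q = \<beta> - \<alpha>" for q by auto
    then show ?thesis using True by simp
  next
    case False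
    then have "\<beta> \<noteq> \<alpha> + q" for q by auto
    then show ?thesis using False by simp
  qed
  finally show ?thesis by simp
qed

lemma lookup_mconst_times [simp]: "lookup (mconst c * f) \<beta> = c * lookup f \<beta>"
  for f :: "('e, 'k::semiring_0) mpoly"
  by (simp add: mconst_def lookup_single_times)

lemma mderiv_mconst_times:
  "mderiv \<alpha> (mconst c * f) = mconst c * (mderiv \<alpha> f :: ('e, 'k::field_char_0) mpoly)"
  by (rule mderiv_eqI) (simp add: mult.assoc lookup_mderiv)

text \<open>This rests on \<beta>! = \<beta>_e (\<beta> - e)!. The factor \<beta>_e also covers
  \<beta>_e = 0, where the truncated subtraction leaves \<beta> unchanged but L_e does not divide
  the monomial.\<close>

lemma lookup_mvar_times:
  "lookup (mvar e * f) \<beta> * mfact \<beta> =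
    of_nat (lookup \<beta> e) * (lookup f (\<beta> - Poly_Mapping.single e 1) * mfact (\<beta> - Poly_Mapping.single e 1))"
  for f :: "('e, 'k::field_char_0) mpoly"
proof (cases "lookup \<beta> e = 0")
  case True
  then have "lookup (Poly_Mapping.single e 1 + (\<beta> - Poly_Mapping.single e 1)) e \<noteq> lookup \<beta> e"
    by (simp add: lookup_add)
  then have "Poly_Mapping.single e 1 + (\<beta> - Poly_Mapping.single e 1) \<noteq> \<beta>" by metis
  then show ?thesis
    using True by (simp add: mvar_def lookup_single_times)
next
  case False
  define \<alpha> where "\<alpha> = \<beta> - Poly_Mapping.single e 1"
  have \<beta>: "Poly_Mapping.single e 1 + \<alpha> = \<beta>"
    unfolding \<alpha>_def using False
    by (intro poly_mapping_eqI) (auto simp: lookup_add lookup_minus lookup_single when_def)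
  have "mfact \<beta> = of_nat (lookup \<beta> e) * (mfact \<alpha> :: 'k)"
  proof -
    let ?S = "insert e (keys \<beta>)"
    have "mfact \<beta> = fact (lookup \<beta> e) * (\<Prod>x\<in>keys \<beta> - {e}. fact (lookup \<beta> x) :: 'k)"
      by (subst mfact_superset[of ?S]) (auto simp: prod.insert_remove)
    also have "(\<Prod>x\<in>keys \<beta> - {e}. fact (lookup \<beta> x) :: 'k) = (\<Prod>x\<in>keys \<beta> - {e}. fact (lookup \<alpha> x))"
      by (rule prod.cong) (auto simp: \<alpha>_def lookup_minus lookup_single when_def)
    also have "fact (lookup \<beta> e) = (of_nat (lookup \<beta> e) * fact (lookup \<alpha> e) :: 'k)"
      using False by (simp add: \<alpha>_def lookup_minus fact_reduce)
    also have "\<dots> * (\<Prod>x\<in>keys \<beta> - {e}. fact (lookup \<alpha> x)) = of_nat (lookup \<beta> e) * mfact \<alpha>"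
      using \<beta> by (subst mfact_superset[of ?S \<alpha>]) (auto simp: prod.insert_remove keys_add_nat mult.assoc)
    finally show ?thesis .
  qed
  then show ?thesis
    by (simp add: mvar_def lookup_single_times \<beta> flip: \<alpha>_def One_nat_def)
qed

text \<open>The multinomial theorem with the denominator \<beta>! cleared. In the induction one
  factor of the form is split off and \<open>lookup_mvar_times\<close> lowers \<beta>.\<close>

lemma lookup_linear_form_power:
  assumes "finite E"
  shows "lookup (linear_form E \<mu> ^ k) \<beta> * mfact \<beta> =
    (if keys \<beta> \<subseteq> E \<and> expo_deg \<beta> = k then fact k * (\<Prod>e\<in>E. \<mu> e ^ lookup \<beta> e)
     else 0 :: 'k::field_char_0)"
proof (induction k arbitrary: \<beta>)
  case 0
  then show ?case
    by (auto simp: expo_deg_eq_0_iff lookup_one when_def mfact_def)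
next
  case (Suc k)
  let ?d = "\<lambda>e. \<beta> - Poly_Mapping.single e 1"
  let ?m = "\<lambda>\<beta>. \<Prod>x\<in>E. \<mu> x ^ lookup \<beta> x"
  have \<beta>: "Poly_Mapping.single e 1 + ?d e = \<beta>" if "lookup \<beta> e \<noteq> 0" for e
    using that by (intro poly_mapping_eqI) (auto simp: lookup_add lookup_minus lookup_single when_def)
  have "lookup (linear_form E \<mu> ^ Suc k) \<beta> * mfact \<beta> =
      (\<Sum>e\<in>E. \<mu> e * (lookup (mvar e * linear_form E \<mu> ^ k) \<beta> * mfact \<beta>))"
    by (simp add: linear_form_def sum_distrib_right lookup_sum mult.assoc)
  also have "\<dots> = (\<Sum>e\<in>E. if keys \<beta> \<subseteq> E \<and> expo_deg \<beta> = Suc k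
      then of_nat (lookup \<beta> e) * (fact k * ?m \<beta>) else 0)"
  proof (rule sum.cong[OF refl])
    fix e assume e: "e \<in> E"
    show "\<mu> e * (lookup (mvar e * linear_form E \<mu> ^ k) \<beta> * mfact \<beta>) =
      (if keys \<beta> \<subseteq> E \<and> expo_deg \<beta> = Suc k then of_nat (lookup \<beta> e) * (fact k * ?m \<beta>) else 0)"
    proof (cases "lookup \<beta> e = 0")
      case False
      have "keys \<beta> = insert e (keys (?d e))" "expo_deg \<beta> = Suc (expo_deg (?d e))"
        using \<beta>[OF False] keys_add_nat[of "Poly_Mapping.single e 1" "?d e"]
          expo_deg_add[of "Poly_Mapping.single e 1" "?d e"] by auto
      moreover have "?m \<beta> = \<mu> e * ?m (?d e)"
      proof -
        have "?m \<beta> = \<mu> e ^ lookup \<beta> e * (\<Prod>x\<in>E - {e}. \<mu> x ^ lookup \<beta> x)"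
          using assms e by (simp add: prod.remove)
        also have "(\<Prod>x\<in>E - {e}. \<mu> x ^ lookup \<beta> x) = (\<Prod>x\<in>E - {e}. \<mu> x ^ lookup (?d e) x)"
          by (rule prod.cong) (auto simp: lookup_minus lookup_single when_def)
        also have "\<mu> e ^ lookup \<beta> e = \<mu> e * \<mu> e ^ lookup (?d e) e"
          using False by (simp add: lookup_minus flip: power_Suc)
        finally show ?thesis
          using assms e by (simp add: prod.remove mult.assoc)
      qed
      ultimately show ?thesis
        using e by (simp add: lookup_mvar_times Suc.IH del: One_nat_def)
    qed (simp add: lookup_mvar_times)
  qed
  also have "\<dots> = (if keys \<beta> \<subseteq> E \<and> expo_deg \<beta> = Suc k then fact (Suc k) * ?m \<beta> else 0)"
  proof -
    have "(\<Sum>e\<in>E. of_nat (lookup \<beta> e) * (fact k * ?m \<beta>)) = fact (Suc k) * ?m \<beta>"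
      if "keys \<beta> \<subseteq> E" "expo_deg \<beta> = Suc k"
    proof -
      \<comment> \<open>The weights \<beta>_e add up to the total degree, which turns
        \<open>fact k\<close> into \<open>fact (Suc k)\<close>.\<close>
      have "(\<Sum>e\<in>E. of_nat (lookup \<beta> e) :: 'k) = of_nat (Suc k)"
        using expo_deg_superset[OF assms that(1)] that(2) by (simp flip: of_nat_sum)
      then show ?thesis by (simp flip: sum_distrib_right)
    qed
    then show ?thesis
      by (cases "keys \<beta> \<subseteq> E \<and> expo_deg \<beta> = Suc k") (simp_all only: if_True if_False simp_thms sum.neutral_const)
  qed
  finally show ?case .
qed

text \<open>Chain rule: every derivative along L_e brings down \<mu>_e and lowers the power by one.
  Through the multinomial formula this becomes a comparison of shifted exponents.\<close>

lemma mderiv_linear_form_power: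
  assumes "finite E"
  shows "mderiv \<alpha> (linear_form E \<mu> ^ k) =
    (if keys \<alpha> \<subseteq> E \<and> expo_deg \<alpha> \<le> k
     then mconst ((\<Prod>e\<in>E. \<mu> e ^ lookup \<alpha> e) * (fact k / fact (k - expo_deg \<alpha>))) *
       linear_form E \<mu> ^ (k - expo_deg \<alpha>)
     else (0 :: ('e, 'k::field_char_0) mpoly))"
proof (rule mderiv_eqI)
  fix \<gamma> :: "'e expo"
  show "lookup (linear_form E \<mu> ^ k) (\<gamma> + \<alpha>) * mfact (\<gamma> + \<alpha>) = lookup
    (if keys \<alpha> \<subseteq> E \<and> expo_deg \<alpha> \<le> k
     then mconst ((\<Prod>e\<in>E. \<mu> e ^ lookup \<alpha> e) * (fact k / fact (k - expo_deg \<alpha>))) *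
       linear_form E \<mu> ^ (k - expo_deg \<alpha>)
     else (0 :: ('e, 'k::field_char_0) mpoly)) \<gamma> * mfact \<gamma>"
    unfolding lookup_linear_form_power[OF assms]
    by (auto simp: mult.assoc lookup_linear_form_power[OF assms] keys_add_nat expo_deg_add
        lookup_add power_add prod.distrib simp del: mult_eq_0_iff)
qed

section \<open>Setting all variables equal\<close>

lemma mdiag_superset:
  "finite S \<Longrightarrow> keys f \<subseteq> S \<Longrightarrow> mdiag f = (\<Sum>\<beta>\<in>S. monom (lookup f \<beta>) (expo_deg \<beta>))"
  unfolding mdiag_def by (rule sum.mono_neutral_left) (auto simp: in_keys_iff)

lemma mdiag_0 [simp]: "mdiag 0 = 0"
  by (simp add: mdiag_def)

lemma mdiag_single [simp]: "mdiag (Poly_Mapping.single \<beta> c) = monom c (expo_deg \<beta>)"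
  by (simp add: mdiag_superset[of "{\<beta>}"])

lemma mdiag_add: "mdiag (f + g) = mdiag f + mdiag g"
  using keys_add[of f g]
  by (simp add: mdiag_superset[of "keys f \<union> keys g"] lookup_add sum.distrib flip: add_monom)

lemma mdiag_sum: "mdiag (sum f S) = (\<Sum>i\<in>S. mdiag (f i))"
  by (induction S rule: infinite_finite_induct) (simp_all add: mdiag_add)

lemma mpoly_eq_sum_single: "f = (\<Sum>\<beta>\<in>keys f. Poly_Mapping.single \<beta> (lookup f \<beta>))"
  by (rule poly_mapping_eqI) (auto simp: lookup_sum lookup_single when_def in_keys_iff)

text \<open>Both sides are bilinear, and on monomials the claim is additivity of the total
  degree.\<close>

lemma mdiag_mult: "mdiag (f * g) = mdiag f * mdiag g"
  for f g :: "('e, 'k::comm_semiring_1) mpoly"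
proof -
  have "mdiag (f * g) = mdiag ((\<Sum>\<beta>\<in>keys f. Poly_Mapping.single \<beta> (lookup f \<beta>)) *
      (\<Sum>\<beta>\<in>keys g. Poly_Mapping.single \<beta> (lookup g \<beta>)))"
    by (simp flip: mpoly_eq_sum_single)
  also have "\<dots> = mdiag f * mdiag g"
    by (simp add: sum_product mdiag_sum mult_single expo_deg_add mult_monom mdiag_def[of f] mdiag_def[of g])
  finally show ?thesis .
qed

lemma mdiag_mconst_times: "mdiag (mconst c * f) = smult c (mdiag f)"
  for f :: "('e, 'k::comm_semiring_1) mpoly"
  by (simp add: mdiag_mult mconst_def monom_0)

text \<open>On the diagonal the linear form becomes (\<Sum> \<mu>_e) u = u. Every later use of the
  condition on the exponents passes through this fact.\<close>

lemma mdiag_linear_form_power: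
  assumes "(\<Sum>e\<in>E. \<mu> e) = 1"
  shows "mdiag (linear_form E \<mu> ^ k) = monom 1 k"
proof (induction k)
  case 0
  then show ?case by (simp flip: single_one)
next
  case (Suc k)
  have "mdiag (linear_form E \<mu>) = monom (\<Sum>e\<in>E. \<mu> e) 1"
    by (simp add: linear_form_def mdiag_sum mdiag_mconst_times mvar_def smult_monom monom_sum)
  then show ?case by (simp add: mdiag_mult Suc assms mult_monom)
qed

section \<open>Finiteness and linearity of the differential operators\<close>

lemma finite_expo_deg_le:
  assumes "finite E"
  shows "finite {\<alpha>. keys \<alpha> \<subseteq> E \<and> expo_deg \<alpha> \<le> n}"
proof -
  let ?S = "{\<alpha>. keys \<alpha> \<subseteq> E \<and> expo_deg \<alpha> \<le> n}"
  let ?T = "{g. \<forall>e. (e \<in> E \<longrightarrow> g e \<in> {..n}) \<and> (e \<notin> E \<longrightarrow> g e = (0::nat))}"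
  have "lookup \<alpha> e \<le> n" if "expo_deg \<alpha> \<le> n" for \<alpha> e
  proof (cases "e \<in> keys \<alpha>")
    case True
    then have "lookup \<alpha> e \<le> expo_deg \<alpha>"
      unfolding expo_deg_def by (intro member_le_sum) auto
    with that show ?thesis by simp
  qed (simp add: in_keys_iff)
  then have "lookup ` ?S \<subseteq> ?T"
    by (auto simp: in_keys_iff)
  moreover have "finite ?T"
    using assms by (intro finite_set_of_finite_funs) auto
  ultimately have "finite (lookup ` ?S)" by (rule finite_subset)
  then show ?thesis
    by (rule finite_imageD) (auto intro: inj_onI poly_mapping_eqI)
qed

text \<open>The summation range in \<open>mpser_op\<close> depends on the polynomial; a common
  finite range makes linearity a termwise matter.\<close>

lemma mpser_op_superset:
  "finite S \<Longrightarrow> (\<And>\<alpha>. \<alpha> \<notin> S \<Longrightarrow> mderiv \<alpha> f = 0) \<Longrightarrow> mpser_op A f = (\<Sum>\<alpha>\<in>S. mconst (A \<alpha>) * mderiv \<alpha> f)"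
  unfolding mpser_op_def by (rule sum.mono_neutral_left) auto

lemma mderiv_0 [simp]: "mderiv \<alpha> 0 = 0"
  by (simp add: mderiv_def)

lemma mpser_op_0 [simp]: "mpser_op A 0 = 0"
  by (simp add: mpser_op_def)

lemma mpser_op_add: "mpser_op A (f + g) = mpser_op A f + mpser_op A g"
  for f g :: "('e, 'k::field_char_0) mpoly"
proof -
  let ?S = "{\<alpha>. mderiv \<alpha> f \<noteq> 0} \<union> {\<alpha>. mderiv \<alpha> g \<noteq> 0}"
  have "mpser_op A h = (\<Sum>\<alpha>\<in>?S. mconst (A \<alpha>) * mderiv \<alpha> h)" if "h \<in> {f, g, f + g}" for h
    using that by (intro mpser_op_superset) (auto simp: finite_mderiv_nonzero mderiv_add)
  then show ?thesis
    by (simp add: mderiv_add distrib_left sum.distrib)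
qed

lemma mpser_op_mconst_times: "mpser_op A (mconst c * f) = mconst c * mpser_op A f"
  for f :: "('e, 'k::field_char_0) mpoly"
proof -
  let ?S = "{\<alpha>. mderiv \<alpha> f \<noteq> 0}"
  have "mpser_op A h = (\<Sum>\<alpha>\<in>?S. mconst (A \<alpha>) * mderiv \<alpha> h)" if "h \<in> {f, mconst c * f}" for h
    using that by (intro mpser_op_superset) (auto simp: finite_mderiv_nonzero mderiv_mconst_times)
  then show ?thesis
    by (simp add: mderiv_mconst_times sum_distrib_left mult.left_commute)
qed

lemma mpser_op_sum: "mpser_op A (sum f S) = (\<Sum>i\<in>S. mpser_op A (f i :: ('e, 'k::field_char_0) mpoly))"
  by (induction S rule: infinite_finite_induct) (simp_all add: mpser_op_add)

section \<open>Operators in one variable\<close>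

lemma fact_mult_pochhammer: "fact m * pochhammer (of_nat (Suc m)) n = (fact (m + n) :: 'k::field_char_0)"
  by (simp add: pochhammer_fact pochhammer_product' add.commute)

lemma fps_op_superset:
  assumes "degree f \<le> N"
  shows "fps_op a f = (\<Sum>n\<le>N. smult (a $ n) ((pderiv ^^ n) f))"
proof -
  have "(pderiv ^^ n) f = 0" if "n > degree f" for n
    using that by (intro poly_eqI) (simp add: coeff_higher_pderiv coeff_eq_0)
  then show ?thesis
    unfolding fps_op_def using assms by (intro sum.mono_neutral_left) auto
qed

lemma fps_op_0 [simp]: "fps_op a 0 = 0"
  by (simp add: fps_op_def)

lemma fps_op_add: "fps_op a (f + g) = fps_op a f + fps_op a g"
proof -
  let ?N = "max (degree f) (degree g)"
  have "degree (f + g) \<le> ?N" by (rule degree_add_le_max)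
  then show ?thesis
    by (simp add: fps_op_superset[of _ ?N] higher_pderiv_add smult_add_right sum.distrib)
qed

lemma smult_sum_right: "smult c (\<Sum>i\<in>S. f i) = (\<Sum>i\<in>S. smult c (f i))"
  by (induction S rule: infinite_finite_induct) (simp_all add: smult_add_right)

lemma fps_op_smult: "fps_op a (smult c f) = smult c (fps_op a f)"
  by (subst fps_op_superset[of _ "degree f"])
    (simp_all add: fps_op_def higher_pderiv_smult smult_sum_right mult.commute degree_smult_le)

lemma fps_op_sum: "fps_op a (sum f S) = (\<Sum>i\<in>S. fps_op a (f i))"
  by (induction S rule: infinite_finite_induct) (simp_all add: fps_op_add)

lemma fps_op_monom:
  "fps_op a (monom 1 k) = (\<Sum>n\<le>k. monom (a $ n * (fact k / fact (k - n))) (k - n))"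
proof -
  have "(pderiv ^^ n) (monom 1 k :: 'a poly) = monom (fact k / fact (k - n)) (k - n)" if "n \<le> k" for n
    using that
    by (intro poly_eqI) (auto simp: coeff_higher_pderiv simp del: of_nat_Suc simp flip: fact_mult_pochhammer)
  then show ?thesis
    by (simp add: fps_op_superset[OF degree_monom_le] smult_monom)
qed

text \<open>One-variable counterpart of \<open>lookup_mderiv\<close>: after rescaling by m!, the
  operator is a weighted sum of shifts.\<close>

lemma coeff_fps_op:
  assumes "degree f \<le> N"
  shows "coeff (fps_op a f) m * fact m = (\<Sum>n\<le>N. a $ n * (fact (m + n) * coeff f (m + n)))"
  unfolding fps_op_superset[OF assms] coeff_sum sum_distrib_right
  by (intro sum.cong refl)
    (simp add: coeff_higher_pderiv mult_ac del: of_nat_Suc flip: fact_mult_pochhammer)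

text \<open>Derivatives of equal order |\<alpha>| = n produce the same multiple of the same power of
  u, up to factors A_\<alpha> \<mu>^\<alpha> that add up to coefficient n of the substituted
  series.\<close>

lemma mdiag_mpser_op_linear_form_power:
  fixes A :: "('e, 'k::field_char_0) mpser"
  assumes "finite E" "(\<Sum>e\<in>E. \<mu> e) = 1"
  shows "mdiag (mpser_op A (linear_form E \<mu> ^ k)) = fps_op (mpser_subst E \<mu> A) (monom 1 k)"
proof -
  let ?S = "{\<alpha>. keys \<alpha> \<subseteq> E \<and> expo_deg \<alpha> \<le> k}"
  let ?m = "\<lambda>\<alpha>. A \<alpha> * (\<Prod>e\<in>E. \<mu> e ^ lookup \<alpha> e)"
  have fin: "finite ?S" by (rule finite_expo_deg_le[OF assms(1)])
  have "mdiag (mpser_op A (linear_form E \<mu> ^ k)) = (\<Sum>\<alpha>\<in>?S. mdiag (mconst (A \<alpha>) * mderiv \<alpha> (linear_form E \<mu> ^ k)))"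
    by (subst mpser_op_superset[OF fin]) (auto simp: mderiv_linear_form_power[OF assms(1)] mdiag_sum)
  also have "\<dots> = (\<Sum>\<alpha>\<in>?S. monom (?m \<alpha> * (fact k / fact (k - expo_deg \<alpha>))) (k - expo_deg \<alpha>))"
    by (intro sum.cong refl) (simp add: mderiv_linear_form_power[OF assms(1)] mdiag_mconst_times
        mdiag_linear_form_power[OF assms(2)] smult_monom)
  also have "\<dots> = (\<Sum>n\<le>k. \<Sum>\<alpha>\<in>{\<alpha>\<in>?S. expo_deg \<alpha> = n}.
      monom (?m \<alpha> * (fact k / fact (k - expo_deg \<alpha>))) (k - expo_deg \<alpha>))"
    by (rule sum.group[symmetric]) (use fin in auto)
  also have "\<dots> = (\<Sum>n\<le>k. monom (mpser_subst E \<mu> A $ n * (fact k / fact (k - n))) (k - n))"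
  proof (rule sum.cong[OF refl])
    fix n assume "n \<in> {..k}"
    then have "{\<alpha>\<in>?S. expo_deg \<alpha> = n} = {\<alpha>. keys \<alpha> \<subseteq> E \<and> expo_deg \<alpha> = n}" by auto
    then show "(\<Sum>\<alpha>\<in>{\<alpha>\<in>?S. expo_deg \<alpha> = n}.
        monom (?m \<alpha> * (fact k / fact (k - expo_deg \<alpha>))) (k - expo_deg \<alpha>)) =
        monom (mpser_subst E \<mu> A $ n * (fact k / fact (k - n))) (k - n)"
      by (simp add: mpser_subst_def monom_sum sum_distrib_right sum_divide_distrib)
  qed
  finally show ?thesis by (simp add: fps_op_monom)
qed

text \<open>On \<open>exp (c(x) L)\<close> the nonlinear and the linear insertion operators coincide; this is where
  the condition on the insertion exponents enters.\<close>

lemma cocycle_exp_fps: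
  assumes "c $ 0 = 0" "finite E" "(\<Sum>e\<in>E. \<mu> e) = 1"
  shows "fps_coeffwise (cocycle A)
      (\<Prod>e\<in>E. fps_binpow (fps_coeffwise (poly_in_var e) (exp_fps c)) (\<mu> e)) =
    fps_coeffwise (\<lambda>f. poly_integral0 (fps_op (mpser_subst E \<mu> A) f)) (exp_fps c)"
proof (rule fps_ext)
  fix n
  let ?a = "mpser_subst E \<mu> A"
  have "mdiag (mpser_op A (\<Sum>k\<le>n. mconst ((c ^ k) $ n / fact k) * linear_form E \<mu> ^ k)) =
      fps_op ?a (\<Sum>k\<le>n. smult ((c ^ k) $ n / fact k) (monom 1 k))"
    by (simp only: mpser_op_sum mpser_op_mconst_times mdiag_sum mdiag_mconst_times fps_op_sum
        fps_op_smult mdiag_mpser_op_linear_form_power[OF assms(2,3)])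
  also have "(\<Sum>k\<le>n. smult ((c ^ k) $ n / fact k) (monom 1 k)) = exp_fps c $ n"
    by (simp add: exp_fps_def smult_monom)
  finally show "fps_coeffwise (cocycle A)
      (\<Prod>e\<in>E. fps_binpow (fps_coeffwise (poly_in_var e) (exp_fps c)) (\<mu> e)) $ n =
    fps_coeffwise (\<lambda>f. poly_integral0 (fps_op ?a f)) (exp_fps c) $ n"
    by (simp add: prod_binpow_exp_fps_nth[OF assms(1,2)] cocycle_def)
qed

section \<open>The Dyson--Schwinger equations\<close>

text \<open>As w p \<ge> 1, each member is raised by at least one order, so coefficient n depends
  only on the coefficients of \<open>F p\<close> below n. This is the contraction property of both
  equations.\<close>

lemma fps_family_sum_X_power_cong:
  fixes F F' :: "'p \<Rightarrow> 'a::comm_semiring_1 fps"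
  assumes "\<And>p. p \<in> P \<Longrightarrow> w p \<ge> 1" "\<And>p i. p \<in> P \<Longrightarrow> i < n \<Longrightarrow> F p $ i = F' p $ i"
  shows "fps_family_sum P (\<lambda>p. fps_X ^ w p * F p) $ n = fps_family_sum P (\<lambda>p. fps_X ^ w p * F' p) $ n"
proof -
  have eq: "(fps_X ^ w p * F p) $ n = (fps_X ^ w p * F' p) $ n" if "p \<in> P" for p
    using assms(1)[OF that] assms(2)[OF that, of "n - w p"] by (simp add: fps_X_power_mult_nth)
  then show ?thesis
    unfolding fps_family_sum_def by (auto intro!: sum.cong)
qed

text \<open>Only members with w p \<le> n reach order n, so all coefficients up to n come from one
  finite sum whose index set is independent of j.\<close>

lemma fps_family_sum_X_power_nth:
  fixes F :: "'p \<Rightarrow> 'a::comm_semiring_1 fps"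
  assumes "finite {p \<in> P. w p \<le> n}" "j \<le> n"
  shows "fps_family_sum P (\<lambda>p. fps_X ^ w p * F p) $ j =
    (\<Sum>p\<in>{p \<in> P. w p \<le> n}. (fps_X ^ w p * F p) $ j)"
  unfolding fps_family_sum_def fps_nth_Abs_fps using assms
  by (intro sum.mono_neutral_left) (auto simp: fps_X_power_mult_nth split: if_splits)

lemma mult_fps_family_sum_X_power:
  fixes F :: "'p \<Rightarrow> 'a::comm_semiring_1 fps"
  assumes "\<And>n. finite {p \<in> P. w p \<le> n}"
  shows "f * fps_family_sum P (\<lambda>p. fps_X ^ w p * F p) = fps_family_sum P (\<lambda>p. fps_X ^ w p * (f * F p))"
proof (rule fps_ext)
  fix n
  let ?P = "{p \<in> P. w p \<le> n}"
  \<comment> \<open>Up to order n the family may be replaced by a finite sum of series, over which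
    multiplication distributes.\<close>
  have "(f * fps_family_sum P (\<lambda>p. fps_X ^ w p * F p)) $ n = (f * (\<Sum>p\<in>?P. fps_X ^ w p * F p)) $ n"
    unfolding fps_mult_nth
    by (intro sum.cong refl) (simp add: fps_family_sum_X_power_nth[OF assms diff_le_self] fps_sum_nth)
  also have "\<dots> = (\<Sum>p\<in>?P. (fps_X ^ w p * (f * F p)) $ n)"
    by (simp add: sum_distrib_left fps_sum_nth mult_ac)
  finally show "(f * fps_family_sum P (\<lambda>p. fps_X ^ w p * F p)) $ n =
      fps_family_sum P (\<lambda>p. fps_X ^ w p * (f * F p)) $ n"
    by (simp add: fps_family_sum_X_power_nth[OF assms order_refl])
qed

lemma coeff_poly_integral0_0 [simp]: "coeff (poly_integral0 f) 0 = 0"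
  by (simp add: poly_integral0_def coeff_sum)

lemma coeff_poly_integral0_Suc [simp]: "coeff (poly_integral0 f) (Suc m) = coeff f m / of_nat (Suc m)"
  by (auto simp: poly_integral0_def coeff_sum coeff_eq_0 simp del: of_nat_Suc)

text \<open>Puts c^m a(c) into the shape in which \<open>coeff_fps_op\<close> yields the
  coefficients of the operator applied to exp(c L).\<close>

lemma power_mult_compose_nth:
  fixes c :: "'a::comm_semiring_1 fps"
  assumes "c $ 0 = 0"
  shows "(c ^ m * (a oo c)) $ j = (\<Sum>k\<le>j. a $ k * (c ^ (m + k)) $ j)"
proof -
  have "(c ^ m * (a oo c)) $ j = (\<Sum>i=0..j. \<Sum>k\<le>j. a $ k * ((c ^ m) $ i * (c ^ k) $ (j - i)))"
    unfolding fps_mult_nth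
    by (intro sum.cong refl)
      (simp add: fps_compose_nth_upto[OF assms, of _ j] sum_distrib_left mult_ac)
  also have "\<dots> = (\<Sum>k\<le>j. a $ k * (c ^ (m + k)) $ j)"
    by (subst sum.swap) (simp add: power_add fps_mult_nth sum_distrib_left)
  finally show ?thesis .
qed

text \<open>The coefficient of L^(l+1) in exp(c L) is c^(l+1) / (l+1)!. On the right, a_p(c) exp(c
  u) is integrated, which gives the sum of x^(w_p) c^l a_p(c) / (l+1)!. These agree by the equation
  of c multiplied by c^l.\<close>

lemma solves_linear_DSE_exp_fps:
  fixes c :: "'k::field_char_0 fps"
  assumes c0: "c $ 0 = 0"
    and c: "c = fps_family_sum P (\<lambda>p. fps_X ^ w p * (a p oo c))"
    and fin: "\<And>n. finite {p \<in> P. w p \<le> n}"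
  shows "solves_linear_DSE P w a (exp_fps c)"
  unfolding solves_linear_DSE_def
proof (rule fps_ext, rule poly_eqI)
  fix n m
  let ?P = "{p \<in> P. w p \<le> n}"
  let ?I = "\<lambda>p. fps_coeffwise (\<lambda>f. poly_integral0 (fps_op (a p) f)) (exp_fps c)"
  have rhs: "fps_family_sum P (\<lambda>p. fps_X ^ w p * ?I p) $ n = (\<Sum>p\<in>?P. ?I p $ (n - w p))"
    by (subst fps_family_sum_X_power_nth[OF fin order_refl])
      (auto simp: fps_X_power_mult_nth intro!: sum.cong)
  show "coeff (exp_fps c $ n) m = coeff ((1 + fps_family_sum P (\<lambda>p. fps_X ^ w p * ?I p)) $ n) m"
  proof (cases m)
    \<comment> \<open>Integrals from 0 have no constant term in L, and exp(c L) contributes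
      1.\<close>
    case 0
    then show ?thesis by (simp add: rhs coeff_sum coeff_exp_fps[OF c0])
  next
    case (Suc l)
    have op: "coeff (fps_op (a p) (exp_fps c $ j)) l = (c ^ l * (a p oo c)) $ j / fact l" for p j
    proof -
      have "coeff (fps_op (a p) (exp_fps c $ j)) l * fact l = (c ^ l * (a p oo c)) $ j"
        by (simp add: coeff_fps_op[OF degree_exp_fps[OF c0]] coeff_exp_fps[OF c0]
            power_mult_compose_nth[OF c0])
      then show ?thesis by (simp add: field_simps)
    qed
    have "c ^ Suc l = c ^ l * fps_family_sum P (\<lambda>p. fps_X ^ w p * (a p oo c))"
      using c by (simp add: mult.commute)
    also have "\<dots> = fps_family_sum P (\<lambda>p. fps_X ^ w p * (c ^ l * (a p oo c)))"
      by (rule mult_fps_family_sum_X_power[OF fin])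
    finally have "(c ^ Suc l) $ n = (\<Sum>p\<in>?P. (c ^ l * (a p oo c)) $ (n - w p))"
      by (auto simp: fps_family_sum_X_power_nth[OF fin order_refl] fps_X_power_mult_nth
          simp del: power_Suc intro!: sum.cong)
    then have "coeff (exp_fps c $ n) m = (\<Sum>p\<in>?P. (c ^ l * (a p oo c)) $ (n - w p)) / fact (Suc l)"
      by (simp only: coeff_exp_fps[OF c0] Suc)
    also have "\<dots> = (\<Sum>p\<in>?P. coeff (?I p $ (n - w p)) m)"
      by (simp add: Suc op sum_divide_distrib mult.commute)
    also have "\<dots> = coeff ((1 + fps_family_sum P (\<lambda>p. fps_X ^ w p * ?I p)) $ n) m"
      by (simp add: rhs coeff_sum Suc del: fps_coeffwise_nth)
    finally show ?thesis .
  qed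
qed

text \<open>Coefficient i of a composition is a finite sum determined by the coefficients up to i,
  whatever the constant term; so the right-hand side is a contraction on all series.\<close>

lemma ex1_DSE_fixed_point:
  fixes A :: "'p \<Rightarrow> ('e, 'k::field_char_0) mpser"
  assumes "\<And>p. p \<in> P \<Longrightarrow> w p \<ge> 1"
  shows "\<exists>!G. G = 1 + fps_family_sum P (\<lambda>p. fps_X ^ w p *
       fps_coeffwise (cocycle (A p))
         (\<Prod>e\<in>E p. fps_binpow (fps_coeffwise (poly_in_var e) G) (\<mu> p e)))"
proof (rule ex1_fps_fixed_point)
  fix F G :: "'k poly fps" and n
  assume FG: "\<And>i. i < n \<Longrightarrow> F $ i = G $ i"
  have "(\<Prod>e\<in>E p. fps_binpow (fps_coeffwise (poly_in_var e) F) (\<mu> p e)) $ i =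
      (\<Prod>e\<in>E p. fps_binpow (fps_coeffwise (poly_in_var e) G) (\<mu> p e)) $ i" if "i < n" for p i
    using that unfolding fps_binpow_def
    by (intro fps_prod_nth_cong[OF _ order_refl] fps_compose_nth_cong) (simp add: FG)
  then show "(1 + fps_family_sum P (\<lambda>p. fps_X ^ w p *
       fps_coeffwise (cocycle (A p))
         (\<Prod>e\<in>E p. fps_binpow (fps_coeffwise (poly_in_var e) F) (\<mu> p e)))) $ n =
    (1 + fps_family_sum P (\<lambda>p. fps_X ^ w p *
       fps_coeffwise (cocycle (A p))
         (\<Prod>e\<in>E p. fps_binpow (fps_coeffwise (poly_in_var e) G) (\<mu> p e)))) $ n"
    unfolding fps_add_nth
    by (intro arg_cong2[of _ _ _ _ "(+)"] refl fps_family_sum_X_power_cong assms) simp_all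
qed

lemma ex1_linear_DSE:
  fixes a :: "'p \<Rightarrow> 'k::field_char_0 fps"
  assumes "\<And>p. p \<in> P \<Longrightarrow> w p \<ge> 1"
  shows "\<exists>!G. solves_linear_DSE P w a G"
  unfolding solves_linear_DSE_def
proof (rule ex1_fps_fixed_point)
  fix F G :: "'k poly fps" and n
  assume "\<And>i. i < n \<Longrightarrow> F $ i = G $ i"
  then show "(1 + fps_family_sum P (\<lambda>p. fps_X ^ w p *
       fps_coeffwise (\<lambda>f. poly_integral0 (fps_op (a p) f)) F)) $ n =
    (1 + fps_family_sum P (\<lambda>p. fps_X ^ w p *
       fps_coeffwise (\<lambda>f. poly_integral0 (fps_op (a p) f)) G)) $ n"
    unfolding fps_add_nth
    by (intro arg_cong2[of _ _ _ _ "(+)"] refl fps_family_sum_X_power_cong assms) simp_all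
qed

theorem theorem3p12:
  fixes P :: "'p set" and w :: "'p \<Rightarrow> nat" and E :: "'p \<Rightarrow> 'e set"
    and \<mu> :: "'p \<Rightarrow> 'e \<Rightarrow> 'k::field_char_0"
    and A :: "'p \<Rightarrow> ('e, 'k) mpser"
  assumes "\<And>p. p \<in> P \<Longrightarrow> w p \<ge> 1"
    and "\<And>n. finite {p \<in> P. w p = n}"
    and "\<And>p. p \<in> P \<Longrightarrow> finite (E p)"
    and "\<And>p. p \<in> P \<Longrightarrow> A p \<in> mpser_on (E p)"
    and "\<And>p. p \<in> P \<Longrightarrow> (\<Sum>e\<in>E p. \<mu> p e) = 1"
  shows "(\<exists>!G. solves_DSE P w E \<mu> A G) \<and>
         (\<exists>!G. solves_linear_DSE P w (\<lambda>p. mpser_subst (E p) (\<mu> p) (A p)) G) \<and>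
         (THE G. solves_DSE P w E \<mu> A G) =
         (THE G. solves_linear_DSE P w (\<lambda>p. mpser_subst (E p) (\<mu> p) (A p)) G)"
proof -
  define a where "a = (\<lambda>p. mpser_subst (E p) (\<mu> p) (A p))"
  have fin: "finite {p \<in> P. w p \<le> n}" for n
  proof -
    have "{p \<in> P. w p \<le> n} = (\<Union>i\<le>n. {p \<in> P. w p = i})" by auto
    then show ?thesis using assms(2) by simp
  qed
  \<comment> \<open>The exponent c solves a scalar equation with the same contraction
    property.\<close>
  have "\<exists>!c. c = fps_family_sum P (\<lambda>p. fps_X ^ w p * (a p oo c))"
    by (intro ex1_fps_fixed_point fps_family_sum_X_power_cong assms(1) fps_compose_nth_cong) auto
  then obtain c where c: "c = fps_family_sum P (\<lambda>p. fps_X ^ w p * (a p oo c))" by blast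
  \<comment> \<open>No p has weight 0, so nothing contributes to order 0.\<close>
  have c0: "c $ 0 = 0"
    using assms(1) by (subst c, subst fps_family_sum_X_power_nth[OF fin order_refl])
      (fastforce simp: fps_X_power_mult_nth intro!: sum.neutral)
  have lin: "solves_linear_DSE P w a (exp_fps c)"
    using c0 c fin by (rule solves_linear_DSE_exp_fps)
  \<comment> \<open>\<open>cocycle_exp_fps\<close> identifies the two right-hand sides at exp(c L)
    member by member.\<close>
  have "fps_family_sum P (\<lambda>p. fps_X ^ w p * fps_coeffwise (cocycle (A p))
         (\<Prod>e\<in>E p. fps_binpow (fps_coeffwise (poly_in_var e) (exp_fps c)) (\<mu> p e))) =
      fps_family_sum P (\<lambda>p. fps_X ^ w p *
        fps_coeffwise (\<lambda>f. poly_integral0 (fps_op (a p) f)) (exp_fps c))"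
    by (intro fps_ext fps_family_sum_X_power_cong assms(1))
      (simp_all only: a_def cocycle_exp_fps[OF c0 assms(3,5)])
  moreover have "exp_fps c $ 0 = 1"
    by (simp add: exp_fps_def)
  ultimately have sol: "solves_DSE P w E \<mu> A (exp_fps c)"
    using lin by (simp only: solves_DSE_def solves_linear_DSE_def)
  have ex1: "\<exists>!G. solves_DSE P w E \<mu> A G"
  proof (rule ex1I)
    show "solves_DSE P w E \<mu> A (exp_fps c)" by (rule sol)
    define T where "T = (\<lambda>G. 1 + fps_family_sum P (\<lambda>p. fps_X ^ w p * fps_coeffwise (cocycle (A p))
      (\<Prod>e\<in>E p. fps_binpow (fps_coeffwise (poly_in_var e) G) (\<mu> p e))))"
    have "\<exists>!G. G = T G"
      unfolding T_def by (rule ex1_DSE_fixed_point[OF assms(1)])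
    moreover have "G = T G" if "solves_DSE P w E \<mu> A G" for G
      using that unfolding T_def solves_DSE_def by (rule conjunct2)
    ultimately show "G = exp_fps c" if "solves_DSE P w E \<mu> A G" for G
      using that sol by blast
  qed
  have ex1_lin: "\<exists>!G. solves_linear_DSE P w a G"
    by (rule ex1_linear_DSE[OF assms(1)])
  have "(THE G. solves_DSE P w E \<mu> A G) = exp_fps c"
    using ex1 sol by (rule the1_equality)
  moreover have "(THE G. solves_linear_DSE P w a G) = exp_fps c"
    using ex1_lin lin by (rule the1_equality)
  ultimately show ?thesis
    using ex1 ex1_lin by (simp only: a_def simp_thms)
qed

end
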